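(* Let $d\ge1$, $n\ge1$, $N:=\{1,\dots,n\}$, $N_0:=\{0,1,\dots,n\}$. For each $k\in N_0$ let $a^k\in\mathbb{R}^d$ have all entries strictly positive, let $\mathcal{P}_k\subset\mathbb{R}^d$ be the corresponding generalized cross polytope, and let $\mathcal{D}\subset\mathbb{R}^{d+n}$ be the associated polytope (all notation as in the context). For every $k_1,k_2\in N_0$ with $k_1<k_2$, every $j\in[d]$, and every $s\in\{\pm1\}^d$, the inequality $$\sum_{i\in[d]}s_i\,\alpha^{k_1,k_2}_i(j)\,x_i+\sum_{k\in N}\Bigl(M^{k_1,k_2}_0(j)-M^{k_1,k_2}_k(j)\Bigr)z_k\le M^{k_1,k_2}_0(j)$$ describes a facet of $\mathcal{D}$.
   Context: $[d]:=\{1,\dots,d\}$. For $k\in N_0$, the generalized cross polytope is $\mathcal{P}_k:=\{x\in\mathbb{R}^d:\ \sum_{i\in[d]}s_i a^k_i x_i\le 1\text{ for all }s\in\{\pm1\}^d\}$, equivalently $\{x:\sum_i a^k_i|x_i|\le1\}$. For $k\in N$, $\mathbf{e}_k$ is the $k$-th standard unit vector of $\mathbb{R}^n$, and $\mathbf{e}_0$ is the zero vector of $\mathbb{R}^n$. The polytope $\mathcal{D}$ is the convex hull in $\mathbb{R}^{d+n}$ (points written $(x,z)$ with $x\in\mathbb{R}^d$, $z\in\mathbb{R}^n$) of $\bigcup_{k\in N_0}\mathcal{P}_k\times\{\mathbf{e}_k\}$. For $k_1,k_2\in N_0$ with $k_1<k_2$ and $j\in[d]$, let $r^{k_1,k_2}_j:=a^{k_1}_j/a^{k_2}_j$.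 For $i,j\in[d]$ define $\alpha^{k_1,k_2}_i(j):=\min\{a^{k_1}_i,\ r^{k_1,k_2}_j a^{k_2}_i\}$; equivalently, it equals $a^{k_1}_i$ if $r^{k_1,k_2}_i\le r^{k_1,k_2}_j$ and $r^{k_1,k_2}_j a^{k_2}_i$ if $r^{k_1,k_2}_i\ge r^{k_1,k_2}_j$. For each $k\in N_0$ define $M^{k_1,k_2}_k(j):=\max_{i\in[d]}\alpha^{k_1,k_2}_i(j)/a^k_i$. An inequality $\gamma^\top y\le\beta$ describes a facet of a polytope $\mathcal{Q}\subset\mathbb{R}^m$ if it is valid (satisfied by all points of $\mathcal{Q}$) and the face $\mathcal{Q}\cap\{y:\gamma^\top y=\beta\}$ has dimension $\dim\mathcal{Q}-1$. *)

theory Defs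
  imports "HOL-Analysis.Analysis"
begin

(* Here d = CARD('d) and n = CARD('n). The index sets N = {1..n} and N_0 = {0..n} are sets of
   natural numbers. The coordinates of real^'n are numbered by a bijection idx from {1..n} onto
   the type 'n, so that the coordinate z_k of z is z $ idx k. *)

definition sign_vectors :: "(real^'d) set" where
  "sign_vectors = {s. \<forall>i. s $ i \<in> {-1, 1}}"

definition cross_polytope :: "real^'d \<Rightarrow> (real^'d) set" where
  "cross_polytope v = {x. \<forall>s\<in>sign_vectors. (\<Sum>i\<in>UNIV. s $ i * v $ i * x $ i) \<le> 1}"

definition unit_vec :: "(nat \<Rightarrow> 'n) \<Rightarrow> nat \<Rightarrow> real^'n" where
  "unit_vec idx k = (if k = 0 then 0 else axis (idx k) 1)"

definition union_polytope :: "(nat \<Rightarrow> 'n) \<Rightarrow> (nat \<Rightarrow> real^'d) \<Rightarrow> ((real^'d) \<times> (real^'n)) set" where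
  "union_polytope idx a =
     convex hull (\<Union>k\<in>{0..CARD('n)}. cross_polytope (a k) \<times> {unit_vec idx k})"

definition ratio :: "(nat \<Rightarrow> real^'d) \<Rightarrow> nat \<Rightarrow> nat \<Rightarrow> 'd \<Rightarrow> real" where
  "ratio a k1 k2 j = a k1 $ j / a k2 $ j"

(* alpha a k1 k2 j i is the i-th coefficient for the choice j. *)
definition alpha :: "(nat \<Rightarrow> real^'d) \<Rightarrow> nat \<Rightarrow> nat \<Rightarrow> 'd \<Rightarrow> 'd \<Rightarrow> real" where
  "alpha a k1 k2 j i = min (a k1 $ i) (ratio a k1 k2 j * a k2 $ i)"

definition M :: "(nat \<Rightarrow> real^'d) \<Rightarrow> nat \<Rightarrow> nat \<Rightarrow> 'd \<Rightarrow> nat \<Rightarrow> real" where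
  "M a k1 k2 j k = Max (range (\<lambda>i. alpha a k1 k2 j i / a k $ i))"

definition describes_facet :: "'v::euclidean_space \<Rightarrow> real \<Rightarrow> 'v set \<Rightarrow> bool" where
  "describes_facet g b Q \<longleftrightarrow>
     (\<forall>y\<in>Q. g \<bullet> y \<le> b) \<and> aff_dim (Q \<inter> {y. g \<bullet> y = b}) = aff_dim Q - 1"

lemma describes_facet_iff_facet_of:
  assumes "convex Q" "aff_dim Q > 0"
  shows "describes_facet g b Q \<longleftrightarrow>
           (\<forall>y\<in>Q. g \<bullet> y \<le> b) \<and> (Q \<inter> {y. g \<bullet> y = b}) facet_of Q"
proof -
  have "Q \<inter> {y. g \<bullet> y = b} \<noteq> {}" if "aff_dim (Q \<inter> {y. g \<bullet> y = b}) = aff_dim Q - 1"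
    using that assms(2) by (metis aff_dim_empty diff_gt_0_iff_gt diff_add_cancel
        add.left_inverse less_irrefl)
  then show ?thesis
    using face_of_Int_supporting_hyperplane_le[OF assms(1)]
    unfolding describes_facet_def facet_of_def by blast
qed

lemma inner_coefficients:
  fixes x u :: "real^'d" and z :: "real^'n" and c :: "nat \<Rightarrow> real"
  shows "(u, \<Sum>k=1..m. c k *\<^sub>R unit_vec idx k) \<bullet> (x, z) =
           (\<Sum>i\<in>UNIV. u $ i * x $ i) + (\<Sum>k=1..m. c k * z $ idx k)"
  by (auto simp: inner_prod_def inner_vec_def[of u x] inner_sum_left unit_vec_def inner_axis'
      intro!: sum.cong)

end

theory Submission imports Defs begin

text \<open>
  Write \<open>e\<^sub>k\<close> for the \<open>k\<close>-th unit vector, with \<open>e\<^sub>0 = 0\<close>. On the slice \<open>P\<^sub>k \<times> {e\<^sub>k}\<close> the inequality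
  reads \<open>\<Sum>i. s\<^sub>i \<alpha>\<^sub>i x\<^sub>i \<le> M\<^sub>k\<close>, and \<open>M\<^sub>k\<close> is by construction the
  maximum of the left-hand side over the cross polytope \<open>P\<^sub>k\<close>, attained at the
  vertex \<open>(s\<^sub>i / a\<^sup>k\<^sub>i) \<cdot> axis i\<close> for every \<open>i\<close> that maximises \<open>\<alpha>\<^sub>i / a\<^sup>k\<^sub>i\<close>. Hence the
  inequality is valid, and it is tight in at least one vertex of every slice.

  The choice of \<open>\<alpha>\<close> makes it tight in many vertices of the two slices \<open>k1\<close> and \<open>k2\<close>: the quotient
  \<open>\<alpha>\<^sub>i / a\<^sup>k\<^sup>1\<^sub>i\<close> is maximal for every \<open>i\<close> with \<open>r\<^sub>i \<le> r\<^sub>j\<close>, and \<open>\<alpha>\<^sub>i / a\<^sup>k\<^sup>2\<^sub>i\<close> for every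
  \<open>i\<close> with \<open>r\<^sub>i \<ge> r\<^sub>j\<close>. So every direction \<open>i\<close> occurs in one of these slices, and \<open>j\<close> occurs in
  both. With one tight vertex from each of the other \<open>n - 1\<close> slices this gives
  \<open>d + n\<close> tight points, and they are linearly independent: a linear functional vanishing on one
  tight vertex of slice \<open>k\<close> has its \<open>x\<^sub>i\<close>-coefficient determined by its \<open>z\<^sub>k\<close>-coefficient and
  conversely. Slice \<open>0\<close>, where the \<open>z\<close>-part is \<open>0\<close>, starts a chain of vanishing coefficients, which passes
  between the slices \<open>k1\<close> and \<open>k2\<close> through the common direction \<open>j\<close> and reaches all coefficients.
  Linear independence suffices because the origin lies in the polytope but off the
  supporting hyperplane (lemma \<open>describes_facet_if_face_spans\<close>).
\<close>

section \<open>Facets of sets containing the origin\<close>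

text \<open>Since \<open>b > 0\<close>, the origin is affinely independent of the face. A face with trivial
  annihilator therefore has codimension one in the whole space, and adding the origin shows that
  \<open>Q\<close> itself is full-dimensional.\<close>

lemma describes_facet_if_face_spans:
  fixes g :: "'v::euclidean_space"
  assumes "0 \<in> Q" "b > 0" and valid: "\<And>y. y \<in> Q \<Longrightarrow> g \<bullet> y \<le> b"
    and annihilator: "\<And>h. (\<And>y. y \<in> Q \<Longrightarrow> g \<bullet> y = b \<Longrightarrow> h \<bullet> y = 0) \<Longrightarrow> h = 0"
  shows "describes_facet g b Q"
proof -
  define F where "F = Q \<inter> {y. g \<bullet> y = b}"
  have full: "aff_dim (insert 0 F) = DIM('v)"
  proof (rule ccontr)
    assume "aff_dim (insert 0 F) \<noteq> DIM('v)"
    then have "aff_dim (insert 0 F) < DIM('v)"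
      using aff_dim_le_DIM[of "insert 0 F"] by linarith
    then obtain h c where "h \<noteq> 0" and h: "insert 0 F \<subseteq> {y. h \<bullet> y = c}"
      using aff_lowdim_subset_hyperplane by blast
    then have "h \<bullet> y = 0" if "y \<in> Q" "g \<bullet> y = b" for y
      using that by (auto simp: F_def)
    then show False using annihilator \<open>h \<noteq> 0\<close> by blast
  qed
  have "affine hull F \<subseteq> {y. g \<bullet> y = b}"
    by (rule hull_minimal) (auto simp: F_def affine_hyperplane)
  then have "0 \<notin> affine hull F" using \<open>b > 0\<close> by auto
  then have face: "aff_dim F = DIM('v) - 1"
    using full by (simp add: aff_dim_insert)
  have "insert 0 F \<subseteq> Q" using \<open>0 \<in> Q\<close> by (auto simp: F_def)
  then have "aff_dim Q = DIM('v)"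
    using full aff_dim_subset[of "insert 0 F" Q] aff_dim_le_DIM[of Q] by linarith
  then show ?thesis
    using face valid by (simp add: describes_facet_def F_def)
qed

section \<open>Cross polytopes and their union\<close>

lemma sign_vector_cases:
  assumes "s \<in> sign_vectors"
  shows "s $ i = -1 \<or> s $ i = 1"
  using assms by (simp add: sign_vectors_def)

lemma sign_times_le_abs:
  assumes "s \<in> sign_vectors"
  shows "s $ i * x \<le> \<bar>x\<bar>"
  using sign_vector_cases[OF assms, of i] by auto

text \<open>Among the inequalities of the cross polytope, the strongest one at \<open>x\<close> is that of the sign
  pattern of \<open>x\<close>.\<close>

lemma mem_cross_polytope_iff:
  fixes v x :: "real^'d"
  assumes "\<And>i. v $ i \<ge> 0"
  shows "x \<in> cross_polytope v \<longleftrightarrow> (\<Sum>i\<in>UNIV. v $ i * \<bar>x $ i\<bar>) \<le> 1"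
proof
  assume x: "x \<in> cross_polytope v"
  define t :: "real^'d" where "t = (\<chi> i. if x $ i \<ge> 0 then 1 else -1)"
  have "t \<in> sign_vectors" by (simp add: t_def sign_vectors_def)
  then have "(\<Sum>i\<in>UNIV. t $ i * v $ i * x $ i) \<le> 1"
    using x by (auto simp: cross_polytope_def)
  moreover have "(\<Sum>i\<in>UNIV. t $ i * v $ i * x $ i) = (\<Sum>i\<in>UNIV. v $ i * \<bar>x $ i\<bar>)"
    by (intro sum.cong) (auto simp: t_def)
  ultimately show "(\<Sum>i\<in>UNIV. v $ i * \<bar>x $ i\<bar>) \<le> 1" by simp
next
  assume le: "(\<Sum>i\<in>UNIV. v $ i * \<bar>x $ i\<bar>) \<le> 1"
  show "x \<in> cross_polytope v"
    unfolding cross_polytope_def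
  proof (intro CollectI ballI)
    fix t :: "real^'d" assume t: "t \<in> sign_vectors"
    have "t $ i * v $ i * x $ i \<le> v $ i * \<bar>x $ i\<bar>" for i
      using mult_left_mono[OF sign_times_le_abs[OF t, of i "x $ i"] assms[of i]] by (simp add: ac_simps)
    then have "(\<Sum>i\<in>UNIV. t $ i * v $ i * x $ i) \<le> (\<Sum>i\<in>UNIV. v $ i * \<bar>x $ i\<bar>)"
      by (intro sum_mono)
    then show "(\<Sum>i\<in>UNIV. t $ i * v $ i * x $ i) \<le> 1" using le by simp
  qed
qed

lemma zero_in_cross_polytope: "0 \<in> cross_polytope v"
  by (simp add: cross_polytope_def)

lemma vertex_in_cross_polytope:
  assumes "\<And>i. v $ i > 0" "s \<in> sign_vectors"
  shows "axis i (s $ i / v $ i) \<in> cross_polytope v"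
proof -
  have "\<bar>s $ i\<bar> = 1" using sign_vector_cases[OF assms(2), of i] by auto
  have "(\<Sum>l\<in>UNIV. v $ l * \<bar>axis i (s $ i / v $ i) $ l\<bar>)
      = (\<Sum>l\<in>UNIV. if l = i then v $ i * \<bar>s $ i / v $ i\<bar> else 0)"
    by (intro sum.cong) (auto simp: axis_def)
  also have "\<dots> = 1"
    using assms(1)[of i] \<open>\<bar>s $ i\<bar> = 1\<close> by (simp add: abs_divide)
  finally show ?thesis
    using assms(1) by (simp add: mem_cross_polytope_iff less_imp_le)
qed

text \<open>The convention \<open>c 0 = 0\<close> puts slice \<open>0\<close> on the same footing as the others; for the
  inequality of the theorem it holds automatically, as \<open>c k = M\<^sub>0 - M\<^sub>k\<close>.\<close>

lemma inner_on_slice: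
  fixes x u :: "real^'d" and idx :: "nat \<Rightarrow> 'n::finite"
  assumes "inj_on idx {1..m}" "k \<le> m" "c 0 = 0"
  shows "(u, \<Sum>l=1..m. c l *\<^sub>R unit_vec idx l) \<bullet> (x, unit_vec idx k) = u \<bullet> x + c k"
proof -
  have "(\<Sum>l=1..m. c l * unit_vec idx k $ idx l) = (\<Sum>l=1..m. if l = k then c k else 0)"
    using assms by (intro sum.cong) (auto simp: unit_vec_def axis_def inj_on_eq_iff)
  also have "\<dots> = c k"
    using assms by (cases "k = 0") auto
  finally show ?thesis
    by (simp only: inner_coefficients) (simp add: inner_vec_def)
qed

lemma union_polytope_valid:
  assumes "\<And>k x. k \<le> CARD('n) \<Longrightarrow> x \<in> cross_polytope (a k) \<Longrightarrow> g \<bullet> (x, unit_vec idx k) \<le> b"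
    and "y \<in> union_polytope (idx :: nat \<Rightarrow> 'n::finite) a"
  shows "g \<bullet> y \<le> b"
proof -
  have "union_polytope idx a \<subseteq> {y. g \<bullet> y \<le> b}"
    unfolding union_polytope_def
    by (rule hull_minimal) (use assms(1) in \<open>auto simp: convex_halfspace_le\<close>)
  then show ?thesis using assms(2) by blast
qed

lemma slice_in_union_polytope:
  assumes "k \<le> CARD('n)" "x \<in> cross_polytope (a k)"
  shows "(x, unit_vec idx k) \<in> union_polytope (idx :: nat \<Rightarrow> 'n::finite) a"
  unfolding union_polytope_def using assms by (intro hull_inc) auto

section \<open>The coefficients\<close>

lemma M_ge: "alpha a k1 k2 j i / a k $ i \<le> M a k1 k2 j k"
  by (simp add: M_def)

lemma M_attained: "\<exists>i. alpha a k1 k2 j i / a k $ i = M a k1 k2 j k"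
proof -
  have "M a k1 k2 j k \<in> range (\<lambda>i. alpha a k1 k2 j i / a k $ i)"
    unfolding M_def by (rule Max_in) auto
  then show ?thesis by auto
qed

lemma alpha_pos:
  assumes "\<And>i. a k1 $ i > 0" "\<And>i. a k2 $ i > 0"
  shows "alpha a k1 k2 j i > 0"
  using assms by (simp add: alpha_def ratio_def)

text \<open>The quotient \<open>\<alpha>\<^sub>i / a\<^sup>k\<^sup>1\<^sub>i\<close> is \<open>min 1 (r\<^sub>j / r\<^sub>i)\<close>, which has maximum \<open>1\<close>, attained whenever
  \<open>r\<^sub>i \<le> r\<^sub>j\<close>.\<close>

lemma M_first_attained:
  assumes pos: "\<And>i. a k1 $ i > 0" "\<And>i. a k2 $ i > 0"
    and "ratio a k1 k2 i \<le> ratio a k1 k2 j"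
  shows "alpha a k1 k2 j i / a k1 $ i = M a k1 k2 j k1"
proof -
  have "alpha a k1 k2 j l / a k1 $ l \<le> 1" for l
    using pos[of l] by (simp add: alpha_def)
  moreover have "alpha a k1 k2 j i / a k1 $ i = 1"
    using assms(3) pos(1)[of i] pos(2)[of i]
    by (simp add: alpha_def ratio_def[of a k1 k2 i] field_simps)
  ultimately show ?thesis
    using M_attained[of a k1 k2 j k1] M_ge[of a k1 k2 j i k1] by (metis order_antisym)
qed

text \<open>Likewise \<open>\<alpha>\<^sub>i / a\<^sup>k\<^sup>2\<^sub>i\<close> is \<open>min r\<^sub>i r\<^sub>j\<close>, which has maximum \<open>r\<^sub>j\<close>, attained whenever
  \<open>r\<^sub>i \<ge> r\<^sub>j\<close>.\<close>

lemma M_second_attained: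
  assumes pos: "\<And>i. a k2 $ i > 0"
    and "ratio a k1 k2 j \<le> ratio a k1 k2 i"
  shows "alpha a k1 k2 j i / a k2 $ i = M a k1 k2 j k2"
proof -
  have "alpha a k1 k2 j l / a k2 $ l \<le> ratio a k1 k2 j" for l
    using pos[of l] by (simp add: alpha_def pos_divide_le_eq)
  moreover have "alpha a k1 k2 j i / a k2 $ i = ratio a k1 k2 j"
    using assms(2) pos[of i] by (simp add: alpha_def ratio_def[of a k1 k2 i] field_simps)
  ultimately show ?thesis
    using M_attained[of a k1 k2 j k2] M_ge[of a k1 k2 j i k2] by (metis order_antisym)
qed

section \<open>The facet\<close>

text \<open>This is the linear independence of the tight points, in dual form. Here \<open>p\<close> and \<open>q\<close> are the
  coefficients of a linear functional, and \<open>T i k\<close> says that the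
  vertex of slice \<open>k\<close> in direction \<open>i\<close> is tight.\<close>

lemma functional_vanishes_if_zero_on_tight_vertices:
  fixes p :: "'i \<Rightarrow> real" and q :: "nat \<Rightarrow> real"
  assumes vanish: "\<And>i k. k \<le> m \<Longrightarrow> T i k \<Longrightarrow> p i * w i k + q k = 0"
    and w: "\<And>i k. k \<le> m \<Longrightarrow> w i k \<noteq> 0"
    and "q 0 = 0" and le: "k1 \<le> m" "k2 \<le> m"
    and every_slice: "\<And>k. k \<le> m \<Longrightarrow> \<exists>i. T i k"
    and every_direction: "\<And>i. T i k1 \<or> T i k2"
    and common: "T j k1" "T j k2"
  shows "p i = 0" and "k \<le> m \<Longrightarrow> q k = 0"
proof -
  have link: "p i = 0 \<longleftrightarrow> q k = 0" if "k \<le> m" "T i k" for i k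
    using vanish[OF that] w[OF that(1), of i] by auto
  obtain i0 where "T i0 0" using every_slice by blast
  then have "p i0 = 0" using link \<open>q 0 = 0\<close> by blast
  \<comment> \<open>The direction \<open>i0\<close> gives one of the two coefficients, and the common direction \<open>j\<close>
    transfers it to the other.\<close>
  then have "q k1 = 0" "q k2 = 0" using link le every_direction[of i0] common by blast+
  then have p: "p i = 0" for i using link le every_direction by blast
  then show "p i = 0" .
  show "q k = 0" if "k \<le> m" using link every_slice p that by blast
qed

theorem theorem19:
  fixes a :: "nat \<Rightarrow> real^'d" and idx :: "nat \<Rightarrow> 'n::finite"
    and k1 k2 :: nat and j :: 'd and s :: "real^'d"
  assumes "bij_betw idx {1..CARD('n)} UNIV"
    and "\<forall>k\<in>{0..CARD('n)}. \<forall>i. a k $ i > 0"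
    and "k1 \<in> {0..CARD('n)}" and "k2 \<in> {0..CARD('n)}" and "k1 < k2"
    and "s \<in> sign_vectors"
  shows "describes_facet
           (\<chi> i. s $ i * alpha a k1 k2 j i,
            \<Sum>k=1..CARD('n). (M a k1 k2 j 0 - M a k1 k2 j k) *\<^sub>R unit_vec idx k)
           (M a k1 k2 j 0)
           (union_polytope idx a)"
proof -
  define al where "al = alpha a k1 k2 j"
  define Mk where "Mk = M a k1 k2 j"
  define u :: "real^'d" where "u = (\<chi> i. s $ i * al i)"
  define g where "g = (u, \<Sum>k=1..CARD('n). (Mk 0 - Mk k) *\<^sub>R unit_vec idx k)"
  define vert :: "'d \<Rightarrow> nat \<Rightarrow> real^'d" where "vert i k = axis i (s $ i / a k $ i)" for i k
  have pos: "a k $ i > 0" if "k \<le> CARD('n)" for k i using assms(2) that by auto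
  have k: "k1 \<le> CARD('n)" "k2 \<le> CARD('n)" using assms(3,4) by auto
  have al_pos: "al i > 0" for i
    unfolding al_def by (rule alpha_pos) (use pos k in auto)
  have ge: "al i / a k $ i \<le> Mk k" for i k
    unfolding al_def Mk_def by (rule M_ge)
  have s2: "s $ i * s $ i = 1" for i
    using sign_vector_cases[OF assms(6), of i] by auto
  have g_slice: "g \<bullet> (x, unit_vec idx k) = u \<bullet> x + (Mk 0 - Mk k)" if "k \<le> CARD('n)" for x k
    unfolding g_def using assms(1) that
    by (intro inner_on_slice[of idx "CARD('n)" k "\<lambda>k. Mk 0 - Mk k"]) (auto simp: bij_betw_def)

  have valid_slice: "u \<bullet> x \<le> Mk k"
    if "k \<le> CARD('n)" "x \<in> cross_polytope (a k)" for k x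
  proof -
    have term_le: "u $ i * x $ i \<le> Mk k * (a k $ i * \<bar>x $ i\<bar>)" for i
    proof -
      have "u $ i * x $ i \<le> al i * \<bar>x $ i\<bar>"
        using mult_left_mono[OF sign_times_le_abs[OF assms(6), of i "x $ i"], of "al i"] al_pos[of i]
        by (simp add: u_def ac_simps)
      also have "\<dots> \<le> (Mk k * a k $ i) * \<bar>x $ i\<bar>"
        using ge[of i k] pos[OF that(1), of i] by (intro mult_right_mono) (auto simp: field_simps)
      finally show ?thesis by (simp add: ac_simps)
    qed
    have "0 < al j / a k $ j" using al_pos[of j] pos[OF that(1), of j] by simp
    then have "Mk k \<ge> 0" using ge[of j k] by linarith
    have "u \<bullet> x \<le> (\<Sum>i\<in>UNIV. Mk k * (a k $ i * \<bar>x $ i\<bar>))"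
      unfolding inner_vec_def inner_real_def by (intro sum_mono term_le)
    also have "\<dots> = Mk k * (\<Sum>i\<in>UNIV. a k $ i * \<bar>x $ i\<bar>)" by (simp add: sum_distrib_left)
    also have "\<dots> \<le> Mk k * 1"
      using that pos[OF that(1)] \<open>Mk k \<ge> 0\<close>
      by (intro mult_left_mono) (auto simp: mem_cross_polytope_iff less_imp_le)
    finally show ?thesis by simp
  qed

  have tight: "g \<bullet> (vert i k, unit_vec idx k) = Mk 0"
    if "k \<le> CARD('n)" "al i / a k $ i = Mk k" for i k
  proof -
    have "u \<bullet> vert i k = (s $ i * s $ i) * (al i / a k $ i)"
      by (simp add: vert_def inner_axis u_def)
    then show ?thesis using that by (simp add: g_slice s2)
  qed

  have "describes_facet g (Mk 0) (union_polytope idx a)"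
  proof (rule describes_facet_if_face_spans)
    have "(0, unit_vec idx 0) \<in> union_polytope idx a"
      by (intro slice_in_union_polytope zero_in_cross_polytope) simp
    then show "0 \<in> union_polytope idx a" by (simp add: unit_vec_def zero_prod_def)
    have "0 < al j / a 0 $ j" using al_pos[of j] pos[of 0 j] by simp
    then show "Mk 0 > 0" using ge[of j 0] by linarith
    show "g \<bullet> y \<le> Mk 0" if "y \<in> union_polytope idx a" for y
      using that by (rule union_polytope_valid[rotated]) (simp add: g_slice valid_slice)
  next
    fix h assume h0: "\<And>y. y \<in> union_polytope idx a \<Longrightarrow> g \<bullet> y = Mk 0 \<Longrightarrow> h \<bullet> y = 0"
    obtain p q where h: "h = (p, q)" by (cases h)
    have vanish: "p $ i * (s $ i / a k $ i) + q \<bullet> unit_vec idx k = 0"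
      if "k \<le> CARD('n)" "al i / a k $ i = Mk k" for i k
    proof -
      have "vert i k \<in> cross_polytope (a k)"
        unfolding vert_def by (intro vertex_in_cross_polytope pos that assms(6))
      then have "h \<bullet> (vert i k, unit_vec idx k) = 0"
        by (intro h0 slice_in_union_polytope tight that)
      then show ?thesis by (simp add: h vert_def inner_axis)
    qed
    have w: "s $ i / a k $ i \<noteq> 0" if "k \<le> CARD('n)" for i k
      using s2[of i] pos[OF that, of i] by auto
    have q0: "q \<bullet> unit_vec idx 0 = 0" by (simp add: unit_vec_def)
    have first: "al i / a k1 $ i = Mk k1" if "ratio a k1 k2 i \<le> ratio a k1 k2 j" for i
      unfolding al_def Mk_def using that pos k by (intro M_first_attained) auto
    have second: "al i / a k2 $ i = Mk k2" if "ratio a k1 k2 j \<le> ratio a k1 k2 i" for i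
      unfolding al_def Mk_def using that pos k by (intro M_second_attained) auto
    have every_slice: "\<exists>i. al i / a k $ i = Mk k" for k
      unfolding al_def Mk_def by (rule M_attained)
    have every_direction: "al i / a k1 $ i = Mk k1 \<or> al i / a k2 $ i = Mk k2" for i
      using first second linear by blast
    note zero = functional_vanishes_if_zero_on_tight_vertices
      [of "CARD('n)" "\<lambda>i k. al i / a k $ i = Mk k" "($) p" "\<lambda>i k. s $ i / a k $ i"
        "\<lambda>k. q \<bullet> unit_vec idx k", OF vanish w q0 k every_slice every_direction
        first[OF order_refl] second[OF order_refl]]
    have "q $ l = 0" for l
    proof -
      have "l \<in> idx ` {1..CARD('n)}"
        using assms(1) by (simp add: bij_betw_def)
      then obtain k where "k \<in> {1..CARD('n)}" "l = idx k" by blast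
      then show ?thesis using zero(2)[of k] by (simp add: unit_vec_def inner_axis)
    qed
    then show "h = 0" using zero(1) by (simp add: h zero_prod_def vec_eq_iff)
  qed
  then show ?thesis by (simp only: g_def u_def al_def Mk_def)
qed

end
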